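(* There exists a Cameron-Liebler line class $\mathcal{L}$ of parameter $x$ in $\mathrm{AG}(3,5)$ if and only if $x\in\{0,1,12,13,24,25\}$.
   Context: $\mathrm{AG}(3,5)$ is the 3-dimensional affine space over $\mathbb{F}_5$. A line spread of $\mathrm{AG}(3,5)$ is a set of pairwise disjoint lines of $\mathrm{AG}(3,5)$ that partitions the points of $\mathrm{AG}(3,5)$. A Cameron-Liebler line class of parameter $x$ in $\mathrm{AG}(3,5)$ is a set $\mathcal{L}$ of lines of $\mathrm{AG}(3,5)$ such that $|\mathcal{L}\cap\mathcal{S}|=x$ for every line spread $\mathcal{S}$ of $\mathrm{AG}(3,5)$. *)

theory Defs
  imports "HOL-Analysis.Finite_Cartesian_Product" "HOL-Library.Numeral_Type" "HOL-Library.Disjoint_Sets"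
begin

text \<open>
  The numeral type \<open>5\<close> of \<^theory>\<open>HOL-Library.Numeral_Type\<close> carries the arithmetic of the
  integers modulo 5. The library only provides the commutative ring instance for it;
  \<open>F5_inverse\<close> below records that it is a field.
\<close>

type_synonym F5 = 5

type_synonym point = "F5 ^ 3"

lemma F5_inverse:
  fixes a :: F5
  assumes "a \<noteq> 0"
  shows "\<exists>b. a * b = 1"
proof (cases a)
  case (of_int z)
  then have z: "0 \<le> z" "z < 5"
    by simp_all
  with assms of_int have "z \<noteq> 0"
    by auto
  with z have "z \<in> {1, 2, 3, 4}"
    by auto
  with of_int have "a \<in> {1, 2, 3, 4}"
    by auto
  moreover have "(1::F5) * 1 = 1" "(2::F5) * 3 = 1" "(3::F5) * 2 = 1" "(4::F5) * 4 = 1"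
    by simp_all
  ultimately show ?thesis
    by blast
qed

definition lines_AG35 :: "point set set" where
  "lines_AG35 = {{p + t *s d | t. True} | p d. d \<noteq> 0}"

definition line_spread :: "point set set \<Rightarrow> bool" where
  "line_spread S \<longleftrightarrow> S \<subseteq> lines_AG35 \<and> partition_on UNIV S"

definition cameron_liebler_line_class :: "nat \<Rightarrow> point set set \<Rightarrow> bool" where
  "cameron_liebler_line_class x L \<longleftrightarrow>
     L \<subseteq> lines_AG35 \<and> (\<forall>S. line_spread S \<longrightarrow> card (L \<inter> S) = x)"

end

theory Submission
  imports Defs "HOL-Analysis.Cartesian_Space"
begin

text \<open>
  A line class is Cameron-Liebler with parameter \<open>x\<close> iff there is an integer weight \<open>u\<close> on the
  points with total \<open>5 * x\<close> whose sum is 5 on every line of the class and 0 on every other line: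
  double counting gives one direction, and for the other one compares a parallel class with the
  spread obtained from it by turning the lines in one plane into another direction; this makes
  \<open>(deg p - x) / 6\<close> such a weight, where \<open>deg p\<close> counts the lines of the class through \<open>p\<close>.

  A plane has weight \<open>5 * m\<close> and square weight \<open>5 * m * (6 - m)\<close> for a natural number \<open>m\<close>. Over a
  parallel class of planes the \<open>m\<close> sum to \<open>x\<close> and their squares to \<open>x * (x + 5) / 6\<close>, so 12 divides
  \<open>x * (x - 1)\<close>. Up to complements only \<open>x = 4\<close> and \<open>x = 9\<close> remain to be excluded. In the first case
  \<open>0 \<le> u \<le> 4\<close>, but some plane has weight 5 and square weight 25. In the second case
  \<open>-1 \<le> u \<le> 3\<close> and all \<open>m \<le> 3\<close>; summing \<open>(m - 1) * (m - 3)\<close> over the planes through a point rules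
  out the values 1 and 2, so 12 divides the sum 210 of all \<open>u\<^sup>2 + u\<close>, which is absurd.

  For \<open>x = 12\<close> take \<open>u = N mod 5 - 2\<close> with \<open>N\<close> an anisotropic cubic form: on a line, \<open>N\<close> is a polynomial
  of degree exactly 3, so its values sum to 0 in the field and are not all equal.
\<close>

section \<open>Arithmetic and sums over the field with five elements\<close>

lemma UNIV_F5: "(UNIV :: F5 set) = {0, 1, 2, 3, 4}"
proof -
  have "a \<in> {0, 1, 2, 3, 4}" for a :: F5
  proof (cases a)
    case (of_int z)
    then have "z \<in> {0, 1, 2, 3, 4}"
      by auto
    with of_int show ?thesis
      by auto
  qed
  then show ?thesis
    by blast
qed

lemma all_F5: "(\<forall>a::F5. P a) \<longleftrightarrow> P 0 \<and> P 1 \<and> P 2 \<and> P 3 \<and> P 4"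
proof -
  have "(\<forall>a::F5. P a) \<longleftrightarrow> (\<forall>a\<in>{0, 1, 2, 3, 4}. P a)"
    unfolding UNIV_F5 [symmetric] by simp
  then show ?thesis
    by simp
qed

lemma sum_F5: "(\<Sum>t\<in>UNIV. h (t::F5)) = h 0 + h 1 + h 2 + h 3 + h 4"
  unfolding UNIV_F5 by (simp add: add.assoc)

lemma F5_times_eq_0: "a * b = 0 \<Longrightarrow> a = 0 \<or> b = 0" for a b :: F5
proof -
  assume "a * b = 0"
  moreover have "\<exists>c. a * c = 1" if "a \<noteq> 0"
    using that by (rule F5_inverse)
  ultimately show ?thesis
    by (metis mult.left_commute mult.right_neutral mult.commute mult_zero_right)
qed

lemma smult_eq_0: "t *s v = 0 \<Longrightarrow> t = 0 \<or> v = 0" for v :: point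
  by (auto simp: vec_eq_iff dest: F5_times_eq_0)

lemma F5_inverse_smult:
  assumes "(t::F5) \<noteq> 0"
  obtains s where "s \<noteq> 0" "\<And>v::point. s *s (t *s v) = v" "\<And>v::point. t *s (s *s v) = v"
proof -
  obtain s where "t * s = 1"
    using F5_inverse [OF assms] by auto
  moreover from this have "s * t = 1"
    by (simp add: mult.commute)
  ultimately have "s \<noteq> 0" "s *s (t *s v) = v" "t *s (s *s v) = v" for v :: point
    by (auto simp only: vector_smult_assoc vector_smult_lid mult_zero_right zero_neq_one)
  then show ?thesis
    using that by blast
qed

section \<open>Lines\<close>

definition line :: "point \<Rightarrow> point \<Rightarrow> point set" where
  "line p d = range (\<lambda>t. p + t *s d)"

lemma lines_AG35_eq: "lines_AG35 = {line p d |p d. d \<noteq> 0}"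
  by (auto simp: lines_AG35_def line_def full_SetCompr_eq)

lemma inj_line: "d \<noteq> 0 \<Longrightarrow> inj (\<lambda>t. p + t *s d)" for d :: point
  by (rule injI) (metis add_left_cancel eq_iff_diff_eq_0 smult_eq_0 vector_sub_rdistrib)

lemma sum_line: "d \<noteq> 0 \<Longrightarrow> sum h (line p d) = (\<Sum>t\<in>UNIV. h (p + t *s d))"
  unfolding line_def by (simp add: sum.reindex inj_line)

lemma base_in_line [simp]: "p \<in> line p d"
  unfolding line_def by (rule range_eqI [of _ _ 0]) simp

lemma line_shift [simp]: "line (p + t *s d) d = line p d"
proof -
  have "line (p + t *s d) d = (\<lambda>s. p + s *s d) ` range (\<lambda>s. t + s)"
    unfolding line_def image_image by (simp only: vector_sadd_rdistrib add.assoc)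
  moreover have "range (\<lambda>s. t + s) = UNIV"
    by simp
  ultimately show ?thesis
    by (simp add: line_def)
qed

lemma line_eqI: "q \<in> line p d \<Longrightarrow> line q d = line p d"
  using line_shift by (auto simp: line_def [of p d])

lemma line_scale:
  assumes "s \<noteq> 0"
  shows "line p (s *s d) = line p d"
proof -
  obtain r where "s * r = 1"
    using F5_inverse [OF assms] by auto
  then have "t = (t * r) * s" for t
    by (simp add: mult.assoc mult.commute [of r])
  then have "range (\<lambda>t. t * s) = UNIV"
    by blast
  moreover have "line p (s *s d) = (\<lambda>t. p + t *s d) ` range (\<lambda>t. t * s)"
    by (simp add: line_def image_image vector_smult_assoc)
  ultimately show ?thesis
    by (simp add: line_def)
qed

text \<open>Closure under translation along \<open>d\<close> makes \<open>C\<close> a disjoint union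
  of lines of direction \<open>d\<close>, the fibres of \<open>\<lambda>q. line q d\<close>.\<close>

lemma sum_over_lines:
  fixes h :: "point \<Rightarrow> int"
  assumes C: "\<And>q t. q \<in> C \<Longrightarrow> q + t *s d \<in> C" and d: "d \<noteq> 0"
  shows "sum h C = (\<Sum>l\<in>(\<lambda>q. line q d) ` C. sum h l)"
proof -
  have "sum h C = (\<Sum>l\<in>(\<lambda>q. line q d) ` C. sum h {q \<in> C. line q d = l})"
    by (rule sum.image_gen) simp
  also have "\<dots> = (\<Sum>l\<in>(\<lambda>q. line q d) ` C. sum h l)"
  proof (rule sum.cong [OF refl], rule arg_cong [where f = "sum h"])
    fix l assume "l \<in> (\<lambda>q. line q d) ` C"
    then obtain p where p: "p \<in> C" "l = line p d"
      by blast
    then have "l \<subseteq> C"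
      using C by (auto simp: line_def)
    then show "{q \<in> C. line q d = l} = l"
      using p line_eqI by auto
  qed
  finally show ?thesis .
qed

lemma line_sums_dvd_5:
  fixes h :: "point \<Rightarrow> int"
  assumes "\<And>q t. q \<in> C \<Longrightarrow> q + t *s d \<in> C" and "d \<noteq> 0"
    and "\<And>q. q \<in> C \<Longrightarrow> 5 dvd sum h (line q d)"
  shows "5 dvd sum h C"
proof -
  have "5 dvd (\<Sum>l\<in>(\<lambda>q. line q d) ` C. sum h l)"
    by (rule dvd_sum) (use assms in blast)
  then show ?thesis
    using sum_over_lines [of C d h] assms by simp
qed

text \<open>Translation by \<open>t *s d\<close> permutes \<open>C\<close>, so each of the five
  values of \<open>t\<close> contributes one copy of \<open>sum h C\<close>.\<close>

lemma sum_line_sums: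
  fixes h :: "point \<Rightarrow> int"
  assumes C: "\<And>q t. q + t *s d \<in> C \<longleftrightarrow> q \<in> C"
  shows "(\<Sum>q\<in>C. \<Sum>t\<in>UNIV. h (q + t *s d)) = 5 * sum h C"
proof -
  have "(\<Sum>q\<in>C. h (q + t *s d)) = sum h C" for t
  proof -
    have "q - t *s d \<in> C" if "q \<in> C" for q
      using that C [of "q - t *s d" t] by simp
    then show ?thesis
      using C by (intro sum.reindex_bij_witness [of _ "\<lambda>q. q - t *s d" "\<lambda>q. q + t *s d"]) auto
  qed
  then have "(\<Sum>t\<in>UNIV. \<Sum>q\<in>C. h (q + t *s d)) = 5 * sum h C"
    by simp
  then show ?thesis
    by (subst sum.swap)
qed

text \<open>
  The point \<open>q\<close> is counted once for each direction, every other point of \<open>q + V\<close> once for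
  each of the four nonzero multiples of its difference with \<open>q\<close>.
\<close>

lemma sum_lines_through:
  fixes h :: "point \<Rightarrow> int"
  assumes 0: "0 \<in> V" and V: "\<And>t v. v \<in> V \<Longrightarrow> t *s v \<in> V"
  shows "(\<Sum>d\<in>V - {0}. \<Sum>t\<in>UNIV. h (q + t *s d)) =
    (int (card V) - 5) * h q + 4 * (\<Sum>v\<in>V. h (q + v))"
proof -
  have scaled: "(\<Sum>d\<in>V - {0}. h (q + t *s d)) = (\<Sum>v\<in>V. h (q + v)) - h q" if t: "t \<noteq> 0" for t
  proof -
    obtain s where s: "s \<noteq> 0" "\<And>v::point. s *s (t *s v) = v" "\<And>v::point. t *s (s *s v) = v"
      using F5_inverse_smult [OF t] by blast
    have "(\<Sum>d\<in>V - {0}. h (q + t *s d)) = (\<Sum>v\<in>V - {0}. h (q + v))"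
      by (rule sum.reindex_bij_witness [of _ "\<lambda>v. s *s v" "\<lambda>v. t *s v"])
        (use s t V in \<open>auto dest: smult_eq_0\<close>)
    then show ?thesis
      using 0 by (simp add: sum_diff1)
  qed
  have "card V \<ge> 1"
    using 0 by (metis One_nat_def Suc_leI card_gt_0_iff empty_iff finite)
  then have unscaled: "(\<Sum>d\<in>V - {0}. h (q + 0 *s d)) = (int (card V) - 1) * h q"
    using 0 by (simp add: card_Diff_singleton of_nat_diff)
  have nonzero: "(1::F5) \<noteq> 0" "(2::F5) \<noteq> 0" "(3::F5) \<noteq> 0" "(4::F5) \<noteq> 0"
    by simp_all
  \<comment> \<open>The coefficient of \<open>h q\<close> is \<open>card V - 1\<close> from
    \<open>t = 0\<close>, less 1 for each of the four nonzero \<open>t\<close>.\<close>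
  have "(\<Sum>t\<in>UNIV. \<Sum>d\<in>V - {0}. h (q + t *s d)) =
      (int (card V) - 1) * h q + 4 * ((\<Sum>v\<in>V. h (q + v)) - h q)"
    unfolding sum_F5 unscaled nonzero [THEN scaled] by simp
  then show ?thesis
    by (subst sum.swap) (simp only: algebra_simps)
qed

text \<open>\<open>V - {0}\<close> splits into punctured lines through the origin, each consisting
  of the four nonzero multiples of one vector, on which \<open>h\<close> is constant.\<close>

lemma sum_punctured_lines_dvd_4:
  fixes h :: "point \<Rightarrow> int"
  assumes V: "\<And>t v. v \<in> V \<Longrightarrow> t *s v \<in> V" and h: "\<And>t v. t \<noteq> 0 \<Longrightarrow> h (t *s v) = h v"
  shows "4 dvd sum h (V - {0})"
proof -
  let ?g = "\<lambda>d. line 0 d"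
  have "sum h (V - {0}) = (\<Sum>l\<in>?g ` (V - {0}). sum h {d \<in> V - {0}. ?g d = l})"
    by (rule sum.image_gen) simp
  also have "4 dvd \<dots>"
  proof (rule dvd_sum)
    fix l assume "l \<in> ?g ` (V - {0})"
    then obtain d where d: "d \<in> V" "d \<noteq> 0" "l = line 0 d"
      by auto
    have "{e \<in> V - {0}. ?g e = l} = (\<lambda>t. t *s d) ` (UNIV - {0})" (is "?A = ?B")
    proof
      show "?A \<subseteq> ?B"
      proof
        fix e assume "e \<in> ?A"
        then have "e \<noteq> 0" "line 0 e = line 0 d"
          using d by auto
        moreover have "e \<in> line 0 e"
          by (auto simp: line_def image_iff intro!: exI [of _ 1])
        ultimately show "e \<in> ?B"
          by (auto simp: line_def image_iff)
      qed
      show "?B \<subseteq> ?A"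
        using V d by (auto simp: line_scale dest: smult_eq_0)
    qed
    moreover have "inj_on (\<lambda>t. t *s d) (UNIV - {0})"
      using inj_line [OF d(2), of 0] by (simp add: inj_on_def)
    ultimately have "sum h {e \<in> V - {0}. ?g e = l} = (\<Sum>t\<in>UNIV - {0}. h (t *s d))"
      by (simp add: sum.reindex)
    also have "\<dots> = (\<Sum>t\<in>UNIV - {0::F5}. h d)"
      using h by (intro sum.cong) auto
    finally show "4 dvd sum h {e \<in> V - {0}. ?g e = l}"
      by (simp add: card_Diff_singleton)
  qed
  finally show ?thesis .
qed

section \<open>Planes\<close>

text \<open>Planes are the sets \<open>{q. dot n q = c}\<close> with \<open>n\<close> nonzero. A
  nonzero multiple of \<open>n\<close> has the same parallel planes, so a sum over normals counts
  each plane through a point four times.\<close>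

definition dot :: "point \<Rightarrow> point \<Rightarrow> F5" where
  "dot v w = v $ 1 * w $ 1 + v $ 2 * w $ 2 + v $ 3 * w $ 3"

lemma dot_simps [simp]:
  "dot 0 v = 0" "dot v 0 = 0"
  "dot v (p + q) = dot v p + dot v q" "dot v (p - q) = dot v p - dot v q" "dot v (t *s p) = t * dot v p"
  by (simp_all add: dot_def algebra_simps)

lemma dot_commute: "dot v w = dot w v"
  by (simp add: dot_def mult.commute)

lemma dot_eq_1:
  assumes "v \<noteq> 0"
  obtains w where "dot v w = 1"
proof -
  obtain i where "v $ i \<noteq> 0"
    using assms by (auto simp: vec_eq_iff)
  then obtain b where "v $ i * b = 1"
    using F5_inverse by blast
  then have "dot v (axis i b) = 1"
    using exhaust_3 [of i] by (auto simp: dot_def axis_def)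
  then show ?thesis
    by (rule that)
qed

lemma dot_eq_0_nonzero:
  obtains d where "d \<noteq> 0" "dot v d = 0"
proof (cases "v $ 1 = 0")
  case True
  then have "dot v (axis 1 1) = 0" "axis 1 1 \<noteq> (0 :: point)"
    by (auto simp: dot_def axis_def vec_eq_iff)
  then show ?thesis
    using that by blast
next
  case False
  then have "dot v (\<chi> i. if i = 1 then - v $ 2 else if i = 2 then v $ 1 else 0) = 0"
    "(\<chi> i. if i = 1 then - v $ 2 else if i = 2 then v $ 1 else 0) \<noteq> (0 :: point)"
    by (auto simp: dot_def vec_eq_iff intro!: exI [of _ 2])
  then show ?thesis
    using that by blast
qed

lemma sum_parallel_planes:
  fixes h :: "point \<Rightarrow> int"
  shows "(\<Sum>c\<in>UNIV. \<Sum>q | dot v q = c. h q) = sum h UNIV"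
  using sum.group [of UNIV UNIV "dot v" h] by simp

text \<open>Translations by multiples of a vector \<open>w\<close> with \<open>dot v w = 1\<close>
  carry the five parallel planes to each other, so each holds a fifth of the 125 points.\<close>

lemma card_plane:
  assumes "v \<noteq> 0"
  shows "card {q. dot v q = c} = 25"
proof -
  obtain w where w: "dot v w = 1"
    using assms by (rule dot_eq_1)
  have eq: "card {q. dot v q = c} = card {q. dot v q = 0}" for c
    by (rule bij_betw_same_card [of "\<lambda>q. q - c *s w"], rule bij_betw_byWitness [of _ "\<lambda>q. q + c *s w"])
      (auto simp: w)
  have "(\<Sum>c\<in>UNIV. \<Sum>q | dot v q = c. 1 :: int) = (\<Sum>c\<in>(UNIV :: F5 set). int (card {q. dot v q = 0}))"
  proof (rule sum.cong [OF refl])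
    fix c
    show "(\<Sum>q | dot v q = c. 1) = int (card {q. dot v q = 0})"
      using eq [of c] by simp
  qed
  then have "card {q. dot v q = 0} = 25"
    using sum_parallel_planes [of "\<lambda>_. 1" v] by simp
  then show ?thesis
    using eq [of c] by simp
qed

text \<open>A point \<open>q\<close> other than \<open>p\<close> is counted for the 24 nonzero
  normals orthogonal to \<open>q - p\<close>; \<open>p\<close> itself is counted for all
  124.\<close>

lemma sum_planes_through:
  fixes h :: "point \<Rightarrow> int"
  shows "(\<Sum>v\<in>UNIV - {0}. \<Sum>q | dot v q = dot v p. h q) = 100 * h p + 24 * sum h UNIV"
proof -
  have "(\<Sum>v\<in>UNIV - {0}. if dot v q = dot v p then h q else 0) = (if q = p then 124 else 24) * h q" for q
  proof (cases "q = p")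
    case True
    then show ?thesis
      by (simp add: card_Diff_singleton)
  next
    case False
    have "{v \<in> UNIV - {0}. dot v q = dot v p} = {v. dot (q - p) v = 0} - {0}"
      by (auto simp: dot_commute [of "q - p"])
    moreover have "card ({v. dot (q - p) v = 0} - {0}) = 24"
      using False by (simp add: card_Diff_singleton card_plane)
    ultimately show ?thesis
      using False by (simp add: sum.If_cases Int_def)
  qed
  moreover have "(\<Sum>q | dot v q = dot v p. h q) = (\<Sum>q\<in>UNIV. if dot v q = dot v p then h q else 0)" for v
    by (simp add: sum.If_cases)
  ultimately have "(\<Sum>v\<in>UNIV - {0}. \<Sum>q | dot v q = dot v p. h q) =
      (\<Sum>q\<in>UNIV. (if q = p then 124 else 24) * h q)"
    by (simp only:) (subst sum.swap, simp)
  also have "\<dots> = (\<Sum>q\<in>UNIV. 24 * h q + (if q = p then 100 * h q else 0))"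
    by (rule sum.cong) auto
  finally show ?thesis
    by (simp add: sum.distrib sum_distrib_left)
qed

section \<open>Cameron-Liebler line classes and weights on points\<close>

definition line_weight :: "nat \<Rightarrow> (point \<Rightarrow> int) \<Rightarrow> bool" where
  "line_weight x u \<longleftrightarrow>
    (\<forall>p d. d \<noteq> 0 \<longrightarrow> (\<Sum>t\<in>UNIV. u (p + t *s d)) \<in> {0, 5}) \<and> sum u UNIV = 5 * int x"

lemma sum_spread:
  fixes h :: "point \<Rightarrow> int"
  assumes "line_spread S"
  shows "(\<Sum>l\<in>S. sum h l) = sum h UNIV"
proof -
  have "\<Union>S = UNIV" "\<forall>A\<in>S. \<forall>B\<in>S. A \<noteq> B \<longrightarrow> A \<inter> B = {}"
    using assms by (auto simp: line_spread_def partition_on_def disjoint_def)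
  then show ?thesis
    using sum.Union_disjoint [of S h] by simp
qed

lemma line_class_of_weight:
  assumes u: "line_weight x u"
  shows "cameron_liebler_line_class x {l \<in> lines_AG35. sum u l = 5}"   unfolding cameron_liebler_line_class_def
proof (intro conjI allI impI)
  let ?L = "{l \<in> lines_AG35. sum u l = 5}"
  fix S assume S: "line_spread S"
  have "sum u l = 5 * of_bool (l \<in> ?L)" if "l \<in> S" for l
  proof -
    have "l \<in> lines_AG35"
      using S that by (auto simp: line_spread_def)
    moreover from this obtain p d where "l = line p d" "d \<noteq> 0"
      by (auto simp: lines_AG35_eq)
    then have "sum u l \<in> {0, 5}"
      using u unfolding line_weight_def by (simp add: sum_line)
    ultimately show ?thesis
      by auto
  qed
  then have "(\<Sum>l\<in>S. sum u l) = 5 * (\<Sum>l\<in>S. of_bool (l \<in> ?L))"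
    by (simp only: sum_distrib_left cong: sum.cong)
  also have "(\<Sum>l\<in>S. of_bool (l \<in> ?L)) = int (card (?L \<inter> S))"
    by (simp add: Int_def conj_commute)
  finally show "card (?L \<inter> S) = x"
    using u S by (simp add: sum_spread line_weight_def)
qed auto

text \<open>Any line of the family through a point \<open>r\<close> must be
  \<open>line r (\<delta> r)\<close>. Letting the direction vary covers both parallel classes and
  spreads switched inside a plane.\<close>

lemma line_spread_directions:
  assumes nonzero: "\<And>q. \<delta> q \<noteq> 0" and const: "\<And>q t. \<delta> (q + t *s \<delta> q) = \<delta> q"
  shows "line_spread (range (\<lambda>q. line q (\<delta> q)))"
proof -
  have "line p (\<delta> p) = line q (\<delta> q)" if "r \<in> line p (\<delta> p)" "r \<in> line q (\<delta> q)" for p q r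
  proof -
    have "line r (\<delta> p) = line p (\<delta> p)" "line r (\<delta> q) = line q (\<delta> q)"
      using that by (simp_all add: line_eqI)
    moreover have "\<delta> r = \<delta> p" "\<delta> r = \<delta> q"
      using that const by (auto simp: line_def)
    ultimately show ?thesis
      by simp
  qed
  moreover have "p \<in> line p (\<delta> p)" for p
    by simp
  ultimately show ?thesis
    using nonzero unfolding line_spread_def partition_on_def disjoint_def lines_AG35_eq
    by (blast 8)
qed

lemma inj_plane:
  fixes d :: point
  assumes "d \<noteq> 0" and "\<And>s. e \<noteq> s *s d"
  shows "inj (\<lambda>(s, t). p + s *s d + t *s e)"
proof (rule injI)
  fix a b :: "F5 \<times> F5"
  assume "(\<lambda>(s, t). p + s *s d + t *s e) a = (\<lambda>(s, t). p + s *s d + t *s e) b"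
  moreover obtain s t s' t' where ab: "a = (s, t)" "b = (s', t')"
    by fastforce
  ultimately have eq: "p + s *s d + t *s e = p + s' *s d + t' *s e"
    by simp
  have "t = t'"
  proof (rule ccontr)
    assume "t \<noteq> t'"
    then have "t - t' \<noteq> 0"
      by simp
    then obtain r where "r *s ((t - t') *s e) = e"
      using F5_inverse_smult by blast
    moreover have "(t - t') *s e = (s' - s) *s d"
      using eq by (simp add: vector_sub_rdistrib algebra_simps)
    ultimately show False
      using assms(2) [of "r * (s' - s)"] by (simp add: vector_smult_assoc)
  qed
  moreover from this have "s = s'"
    using eq injD [OF inj_line [OF assms(1)], of 0 s s'] by simp
  ultimately show "a = b"
    using ab by simp
qed

lemma translate_iff:
  fixes d :: point
  assumes "\<And>q t. q \<in> C \<Longrightarrow> q + t *s d \<in> C"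
  shows "q + t *s d \<in> C \<longleftrightarrow> q \<in> C"
proof -
  have "q + t *s d + (- t) *s d = q"
    by (simp add: vec_eq_iff)
  then show ?thesis
    using assms by metis
qed

section \<open>From a line class to a weight\<close>

context
  fixes x :: nat and L :: "point set set"
  assumes CL: "cameron_liebler_line_class x L"
begin

definition indicator_L :: "point \<Rightarrow> point \<Rightarrow> int" where
  "indicator_L p d = of_bool (line p d \<in> L)"

lemma indicator_L_shift [simp]: "indicator_L (p + t *s d) d = indicator_L p d"
  by (simp add: indicator_L_def)

lemma indicator_L_scale: "t \<noteq> 0 \<Longrightarrow> indicator_L p (t *s d) = indicator_L p d"
  by (simp add: indicator_L_def line_scale)

lemma sum_indicator_directions:
  assumes nonzero: "\<And>q. \<delta> q \<noteq> 0" and const: "\<And>q t. \<delta> (q + t *s \<delta> q) = \<delta> q"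
  shows "(\<Sum>q\<in>UNIV. indicator_L q (\<delta> q)) = 5 * int x"
proof -
  let ?S = "range (\<lambda>q. line q (\<delta> q))" and ?h = "\<lambda>q. indicator_L q (\<delta> q)"
  have S: "line_spread ?S"
    using assms by (rule line_spread_directions)
  have "sum ?h l = 5 * of_bool (l \<in> L)" if "l \<in> ?S" for l
  proof -
    obtain p where p: "l = line p (\<delta> p)"
      using \<open>l \<in> ?S\<close> by blast
    then have "sum ?h l = (\<Sum>t\<in>(UNIV :: F5 set). ?h p)"
      using nonzero const by (simp add: sum_line)
    then show ?thesis
      using p by (simp add: indicator_L_def)
  qed
  then have "(\<Sum>l\<in>?S. sum ?h l) = 5 * (\<Sum>l\<in>?S. of_bool (l \<in> L))"
    by (simp only: sum_distrib_left cong: sum.cong)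
  also have "(\<Sum>l\<in>?S. of_bool (l \<in> L)) = int (card (L \<inter> ?S))"
    by (simp add: Int_def conj_commute)
  also have "card (L \<inter> ?S) = x"
    using CL S by (simp add: cameron_liebler_line_class_def)
  finally show ?thesis
    using sum_spread [OF S, of ?h] by simp
qed

lemma sum_indicator: "d \<noteq> 0 \<Longrightarrow> (\<Sum>q\<in>UNIV. indicator_L q d) = 5 * int x"
  by (rule sum_indicator_directions) auto

text \<open>Compare the parallel class of \<open>d\<close> with the spread in which \<open>C\<close> is covered in direction \<open>e\<close>.\<close>

lemma sum_indicator_switch:
  assumes C: "\<And>q t. q + t *s d \<in> C \<longleftrightarrow> q \<in> C" "\<And>q t. q + t *s e \<in> C \<longleftrightarrow> q \<in> C"
    and "d \<noteq> 0" "e \<noteq> 0"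
  shows "(\<Sum>q\<in>C. indicator_L q d) = (\<Sum>q\<in>C. indicator_L q e)"
proof -
  let ?\<delta> = "\<lambda>q. if q \<in> C then e else d"
  have "(\<Sum>q\<in>UNIV. indicator_L q (?\<delta> q)) = (\<Sum>q\<in>UNIV. indicator_L q d)"
    using assms by (subst (1 2) sum_indicator_directions) auto
  moreover have "(\<Sum>q\<in>UNIV. h q) = (\<Sum>q\<in>C. h q) + (\<Sum>q\<in>-C. h q)" for h :: "point \<Rightarrow> int"
    using sum.subset_diff [of C UNIV h] by (simp add: Compl_eq_Diff_UNIV)
  ultimately show ?thesis
    by simp
qed

text \<open>For independent \<open>d\<close> and \<open>e\<close>, summing the two indicators over
  the plane through \<open>p\<close> spanned by them gives five times the two sides, and
  \<open>sum_indicator_switch\<close> equates these sums.\<close>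

lemma sum_indicator_plane:
  assumes "d \<noteq> 0" "e \<noteq> 0"
  shows "(\<Sum>t\<in>UNIV. indicator_L (p + t *s d) e) = (\<Sum>t\<in>UNIV. indicator_L (p + t *s e) d)"
proof (cases "\<exists>s. e = s *s d")
  case True
  then obtain s where s: "e = s *s d"
    by blast
  with assms have "s \<noteq> 0"
    by auto
  have "indicator_L (p + t *s e) d = indicator_L p d" for t
    using s indicator_L_shift [of p "t * s" d] by (simp add: vector_smult_assoc)
  with s \<open>s \<noteq> 0\<close> show ?thesis
    by (simp add: indicator_L_scale)
next
  case False
  let ?g = "\<lambda>(s, t). p + s *s d + t *s e"
  have inj: "inj ?g"
    using assms(1) False by (intro inj_plane) auto
  have d: "?g (s, t) + r *s d = ?g (s + r, t)" and e: "?g (s, t) + r *s e = ?g (s, t + r)" for r s t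
    by (simp_all add: vector_sadd_rdistrib)
  have step: "q + r *s d \<in> range ?g" "q + r *s e \<in> range ?g" if "q \<in> range ?g" for q r
  proof -
    from that obtain z where "q = ?g z"
      by blast
    then have "q + r *s d = ?g (fst z + r, snd z)" "q + r *s e = ?g (fst z, snd z + r)"
      using d [of "fst z" "snd z"] e [of "fst z" "snd z"] by simp_all
    then show "q + r *s d \<in> range ?g" "q + r *s e \<in> range ?g"
      by (simp_all only: rangeI)
  qed
  then have "(\<Sum>q\<in>range ?g. indicator_L q d) = (\<Sum>q\<in>range ?g. indicator_L q e)"
    using assms by (intro sum_indicator_switch translate_iff)
  moreover have "(\<Sum>q\<in>range ?g. h q) = (\<Sum>s\<in>UNIV. \<Sum>t\<in>UNIV. h (p + s *s d + t *s e))" for h :: "point \<Rightarrow> int"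
    using inj by (simp add: sum.reindex sum.cartesian_product split_def flip: UNIV_Times_UNIV)
  moreover have "indicator_L (p + s *s d + t *s e) d = indicator_L (p + t *s e) d" for s t
    using indicator_L_shift [of "p + t *s e" s d] by (simp add: add.assoc add.commute [of "t *s e"])
  ultimately show ?thesis
    by (simp flip: sum_distrib_left)
qed

text \<open>Each line through \<open>p\<close> arises from four direction vectors, so this is four
  times the number of lines of the class through \<open>p\<close>.\<close>

definition degree_L :: "point \<Rightarrow> int" where
  "degree_L p = (\<Sum>d\<in>UNIV - {0}. indicator_L p d)"

text \<open>By \<open>sum_indicator_plane\<close>, counting all class lines that meet a line becomes
  counting class lines parallel to it: the line itself gets weight 125 - 5, and the whole parallel
  class gives 4 times \<open>5 * x\<close>.\<close>

lemma sum_degree_line: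
  assumes "d \<noteq> 0"
  shows "(\<Sum>t\<in>UNIV. degree_L (p + t *s d)) = 120 * indicator_L p d + 20 * int x"
proof -
  have "(\<Sum>t\<in>UNIV. degree_L (p + t *s d)) = (\<Sum>e\<in>UNIV - {0}. \<Sum>t\<in>UNIV. indicator_L (p + t *s d) e)"
    unfolding degree_L_def by (rule sum.swap)
  also have "\<dots> = (\<Sum>e\<in>UNIV - {0}. \<Sum>t\<in>UNIV. indicator_L (p + t *s e) d)"
    using assms by (intro sum.cong refl sum_indicator_plane) auto
  also have "\<dots> = (int (card (UNIV :: point set)) - 5) * indicator_L p d + 4 * (\<Sum>v\<in>UNIV. indicator_L (p + v) d)"
    by (rule sum_lines_through) auto
  also have "(\<Sum>v\<in>UNIV. indicator_L (p + v) d) = (\<Sum>q\<in>UNIV. indicator_L q d)"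
    by (rule sum.reindex_bij_witness [of _ "\<lambda>q. q - p" "\<lambda>q. p + q"]) auto
  finally show ?thesis
    using assms by (simp add: sum_indicator)
qed

definition excess_L :: "point \<Rightarrow> int" where
  "excess_L p = degree_L p - 4 * int x"

lemma sum_excess_line:
  "d \<noteq> 0 \<Longrightarrow> (\<Sum>t\<in>UNIV. excess_L (p + t *s d)) = 120 * indicator_L p d"
  by (simp add: excess_L_def sum_subtractf sum_degree_line)

text \<open>Summing the excess over the lines through \<open>p\<close> in the plane
  \<open>p + V\<close> gives a multiple of 480, and summing it over the plane along one parallel
  class gives a multiple of 120. The difference shows that 480 divides 20 times the excess at
  \<open>p\<close>.\<close>

lemma excess_dvd_24: "24 dvd excess_L p"
proof -
  define V where "V = {v. dot (axis 1 1) v = 0}"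
  obtain d where d: "d \<noteq> 0" "d \<in> V"
    unfolding V_def using dot_eq_0_nonzero by blast
  have V: "0 \<in> V" "\<And>t v. v \<in> V \<Longrightarrow> t *s v \<in> V" "\<And>q t. q + t *s d \<in> V \<longleftrightarrow> q \<in> V"
    using d by (auto simp: V_def)
  have "card V = 25"
    unfolding V_def by (rule card_plane) (auto simp: vec_eq_iff axis_def)
  then have "20 * excess_L p + 4 * (\<Sum>v\<in>V. excess_L (p + v)) =
      (\<Sum>e\<in>V - {0}. \<Sum>t\<in>UNIV. excess_L (p + t *s e))"
    using V by (subst sum_lines_through) auto
  also have "\<dots> = 120 * (\<Sum>e\<in>V - {0}. indicator_L p e)"
    by (simp add: sum_excess_line sum_distrib_left)
  also obtain j where "(\<Sum>e\<in>V - {0}. indicator_L p e) = 4 * j"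
    using sum_punctured_lines_dvd_4 [of V "indicator_L p"] V indicator_L_scale by (auto elim: dvdE)
  also obtain k where "(\<Sum>v\<in>V. indicator_L (p + v) d) = 5 * k"
  proof -
    have "5 dvd sum (\<lambda>v. indicator_L (p + v) d) (line q d)" for q
      using d indicator_L_shift [of "p + q" _ d] by (simp add: sum_line add.assoc)
    then have "5 dvd (\<Sum>v\<in>V. indicator_L (p + v) d)"
      using V d by (intro line_sums_dvd_5 [of V d]) auto
    then show ?thesis
      using that by (auto elim: dvdE)
  qed
  moreover have "5 * (\<Sum>v\<in>V. excess_L (p + v)) = 120 * (\<Sum>v\<in>V. indicator_L (p + v) d)"
  proof -
    have "5 * (\<Sum>v\<in>V. excess_L (p + v)) = (\<Sum>v\<in>V. \<Sum>t\<in>UNIV. excess_L (p + (v + t *s d)))"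
      using V(3) by (rule sum_line_sums [symmetric])
    also have "\<dots> = (\<Sum>v\<in>V. 120 * indicator_L (p + v) d)"
      using d sum_excess_line by (simp add: add.assoc [symmetric])
    finally show ?thesis
      by (simp add: sum_distrib_left)
  qed
  ultimately have "excess_L p = 24 * (j - k)"
    by simp
  then show ?thesis
    by simp
qed

lemma weight_of_line_class: "\<exists>u. line_weight x u"
proof
  let ?u = "\<lambda>p. excess_L p div 24"
  have u: "24 * ?u p = excess_L p" for p
    using excess_dvd_24 by simp
  have sum_u: "24 * sum ?u A = sum excess_L A" for A
    by (simp add: sum_distrib_left u)
  show "line_weight x ?u"
    unfolding line_weight_def
  proof (intro conjI allI impI)
    fix p d :: point assume "d \<noteq> 0"
    then have "24 * (\<Sum>t\<in>UNIV. ?u (p + t *s d)) = 120 * indicator_L p d"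
      by (simp add: sum_distrib_left u sum_excess_line)
    then show "(\<Sum>t\<in>UNIV. ?u (p + t *s d)) \<in> {0, 5}"
      by (auto simp: indicator_L_def of_bool_def split: if_splits)
  next
    obtain d where d: "d \<noteq> (0 :: point)"
      using dot_eq_0_nonzero by blast
    have "5 * sum excess_L UNIV = (\<Sum>q\<in>UNIV. \<Sum>t\<in>UNIV. excess_L (q + t *s d))"
      by (rule sum_line_sums [symmetric]) simp
    also have "\<dots> = 600 * int x"
      using d by (simp add: sum_excess_line sum_indicator flip: sum_distrib_left)
    finally show "sum ?u UNIV = 5 * int x"
      using sum_u [of UNIV] by simp
  qed
qed

end

lemma line_class_iff_weight:
  "(\<exists>L. cameron_liebler_line_class x L) \<longleftrightarrow> (\<exists>u. line_weight x u)"
  using weight_of_line_class line_class_of_weight by blast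

section \<open>Restrictions on the parameter\<close>

text \<open>Passing to \<open>1 - u\<close> exchanges the line sums 0 and 5, that is, the class and
  its complement; a spread has 25 lines.\<close>

lemma line_weight_complement:
  assumes "line_weight x u"
  shows "x \<le> 25" "line_weight (25 - x) (\<lambda>p. 1 - u p)"
proof -
  have u: "(\<Sum>t\<in>UNIV. u (p + t *s d)) \<in> {0, 5}" if "d \<noteq> 0" for p d
    using assms that by (simp add: line_weight_def)
  have total: "sum u UNIV = 5 * int x"
    using assms by (simp add: line_weight_def)
  obtain d where "d \<noteq> (0 :: point)"
    using dot_eq_0_nonzero by blast
  have "(\<Sum>q\<in>UNIV. \<Sum>t\<in>UNIV. u (q + t *s d)) \<le> (\<Sum>q\<in>(UNIV :: point set). 5)"
    using u [OF \<open>d \<noteq> 0\<close>] by (intro sum_mono) (metis empty_iff insert_iff order.refl zero_le_numeral)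
  then show "x \<le> 25"
    using total by (simp add: sum_line_sums)
  then show "line_weight (25 - x) (\<lambda>p. 1 - u p)"
    using u total by (auto simp: line_weight_def sum_subtractf)
qed

lemma sum_plane_shift:
  fixes h :: "point \<Rightarrow> int"
  shows "(\<Sum>v | dot n v = 0. h (q + v)) = (\<Sum>r | dot n r = dot n q. h r)"
  by (rule sum.reindex_bij_witness [of _ "\<lambda>r. r - q" "\<lambda>v. q + v"]) auto

section \<open>Plane sums and necessary conditions\<close>

context
  fixes x :: nat and u :: "point \<Rightarrow> int"
  assumes weight: "line_weight x u"
begin

lemma line_sum: "d \<noteq> 0 \<Longrightarrow> sum u (line p d) = 0 \<or> sum u (line p d) = 5"
  using weight by (simp add: line_weight_def sum_line)

lemma line_sum_nonneg: "d \<noteq> 0 \<Longrightarrow> 0 \<le> sum u (line p d)"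
  using line_sum [of d p] by auto

lemma total_sum: "sum u UNIV = 5 * int x"
  using weight by (simp add: line_weight_def)

text \<open>
  For \<open>n = 0\<close> this is about the whole space. Both sides evaluate the sum of
  \<open>u q * sum u (line q d)\<close> over all points \<open>q\<close> and directions \<open>d\<close> of the plane; the right-hand
  one by squaring the line sums, which satisfy \<open>s\<^sup>2 = 5 * s\<close>.
\<close>

lemma plane_square_sum:
  fixes n :: point and c :: F5
  defines "C \<equiv> {q. dot n q = c}" and "V \<equiv> {v. dot n v = 0}"
  shows "(int (card V) - 5) * (\<Sum>q\<in>C. (u q)\<^sup>2) + 4 * (sum u C)\<^sup>2 = 5 * (int (card V) - 1) * sum u C"
proof -
  have through: "(\<Sum>d\<in>V - {0}. sum u (line q d)) = (int (card V) - 5) * u q + 4 * sum u C" if "q \<in> C" for q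
  proof -
    have "(\<Sum>d\<in>V - {0}. sum u (line q d)) = (\<Sum>d\<in>V - {0}. \<Sum>t\<in>UNIV. u (q + t *s d))"
      by (intro sum.cong) (auto simp: sum_line)
    also have "\<dots> = (int (card V) - 5) * u q + 4 * (\<Sum>v\<in>V. u (q + v))"
      by (rule sum_lines_through) (auto simp: V_def)
    also have "(\<Sum>v\<in>V. u (q + v)) = sum u C"
      using that by (simp add: V_def C_def sum_plane_shift)
    finally show ?thesis .
  qed
  have "(\<Sum>q\<in>C. u q * (\<Sum>d\<in>V - {0}. sum u (line q d))) =
      (\<Sum>q\<in>C. (int (card V) - 5) * (u q)\<^sup>2 + 4 * sum u C * u q)"
    by (intro sum.cong refl) (simp add: through power2_eq_square algebra_simps del: sum.cong)
  also have "\<dots> = (int (card V) - 5) * (\<Sum>q\<in>C. (u q)\<^sup>2) + 4 * (sum u C)\<^sup>2"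
    by (simp add: sum.distrib power2_eq_square [of "sum u C"] flip: sum_distrib_left)
  finally have left: "(\<Sum>q\<in>C. u q * (\<Sum>d\<in>V - {0}. sum u (line q d))) = \<dots>" .
  have direction: "(\<Sum>q\<in>C. u q * sum u (line q d)) = 5 * sum u C" if d: "d \<in> V - {0}" for d
  proof -
    have C: "q + t *s d \<in> C \<longleftrightarrow> q \<in> C" for q t
      using d by (simp add: C_def V_def)
    have "5 * (\<Sum>q\<in>C. u q * sum u (line q d)) =
        (\<Sum>q\<in>C. \<Sum>t\<in>UNIV. u (q + t *s d) * sum u (line (q + t *s d) d))"
      using C by (rule sum_line_sums [symmetric])
    also have "\<dots> = (\<Sum>q\<in>C. sum u (line q d) * sum u (line q d))"
      using d by (simp add: sum_line sum_distrib_right)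
    also have "\<dots> = (\<Sum>q\<in>C. 5 * sum u (line q d))"
    proof (rule sum.cong [OF refl])
      fix q
      show "sum u (line q d) * sum u (line q d) = 5 * sum u (line q d)"
        using d line_sum [of d q] by auto
    qed
    also have "\<dots> = 5 * (\<Sum>q\<in>C. \<Sum>t\<in>UNIV. u (q + t *s d))"
      using d by (simp add: sum_line sum_distrib_left)
    also have "(\<Sum>q\<in>C. \<Sum>t\<in>UNIV. u (q + t *s d)) = 5 * sum u C"
      using C by (rule sum_line_sums)
    finally show ?thesis
      by simp
  qed
  have "card (V - {0}) = card V - 1" "card V \<ge> 1"
    by (auto simp: V_def card_Diff_singleton Suc_le_eq card_gt_0_iff intro!: exI [of _ 0])
  then have "(\<Sum>d\<in>V - {0}. \<Sum>q\<in>C. u q * sum u (line q d)) = 5 * (int (card V) - 1) * sum u C"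
    using direction by (simp add: of_nat_diff)
  moreover have "(\<Sum>q\<in>C. u q * (\<Sum>d\<in>V - {0}. sum u (line q d))) =
      (\<Sum>d\<in>V - {0}. \<Sum>q\<in>C. u q * sum u (line q d))"
    unfolding sum_distrib_left by (rule sum.swap)
  ultimately show ?thesis
    using left by simp
qed

lemma total_square_sum: "6 * (\<Sum>q\<in>UNIV. (u q)\<^sup>2) = 155 * int x - 5 * (int x)\<^sup>2"
  using plane_square_sum [where n = 0 and c = 0] by (simp add: total_sum power2_eq_square)

text \<open>The line sums at \<open>p\<close> over all 124 directions add up to
  \<open>120 * u p + 20 * x\<close>, and each lies between 0 and 5.\<close>

lemma weight_bounds: "- int x \<le> 6 * u p" "6 * u p \<le> 31 - int x"
proof -
  let ?s = "\<Sum>d\<in>UNIV - {0}. \<Sum>t\<in>UNIV. u (p + t *s d)"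
  have line: "0 \<le> (\<Sum>t\<in>UNIV. u (p + t *s d))" "(\<Sum>t\<in>UNIV. u (p + t *s d)) \<le> 5" if "d \<noteq> 0" for d
    using line_sum [OF that, of p] unfolding sum_line [OF that] by linarith+
  have "0 \<le> ?s"
    using line(1) by (intro sum_nonneg [of "UNIV - {0}"]) simp
  have "?s \<le> (\<Sum>d\<in>UNIV - {0 :: point}. 5)"
    using line by (intro sum_mono) auto
  then have "?s \<le> 620"
    by (simp add: card_Diff_singleton)
  moreover have "?s = 120 * u p + 4 * (\<Sum>v\<in>UNIV. u (p + v))"
    by (subst sum_lines_through) auto
  moreover have "(\<Sum>v\<in>UNIV. u (p + v)) = 5 * int x"
    using sum_plane_shift [where n = 0 and h = u and q = p] by (simp add: total_sum)
  ultimately show "- int x \<le> 6 * u p" "6 * u p \<le> 31 - int x"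
    using \<open>0 \<le> ?s\<close> by linarith+
qed

text \<open>The plane is a union of parallel lines with sums 0 or 5, so \<open>m\<close> counts
  those with sum 5. The square sum is \<open>plane_square_sum\<close> with
  \<open>card V = 25\<close>.\<close>

lemma plane_sums:
  assumes n: "n \<noteq> 0"
  obtains m where "m \<ge> 0" "(\<Sum>q | dot n q = c. u q) = 5 * m" "(\<Sum>q | dot n q = c. (u q)\<^sup>2) = 30 * m - 5 * m\<^sup>2"
proof -
  let ?C = "{q. dot n q = c}"
  obtain d where d: "d \<noteq> 0" "dot n d = 0"
    by (rule dot_eq_0_nonzero)
  have "5 dvd sum u (line q d)" for q
    using line_sum [OF d(1), of q] by auto
  moreover have "q + t *s d \<in> ?C" if "q \<in> ?C" for q t
    using that d by simp
  ultimately have "5 dvd sum u ?C"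
    using d(1) line_sums_dvd_5 by blast
  then obtain m where m: "sum u ?C = 5 * m"
    by (rule dvdE)
  have "sum u ?C = (\<Sum>l\<in>(\<lambda>q. line q d) ` ?C. sum u l)"
    using d by (intro sum_over_lines) auto
  also have "\<dots> \<ge> 0"
    using line_sum_nonneg [OF d(1)] by (intro sum_nonneg [of _ "sum u"]) auto
  finally have "m \<ge> 0"
    using m by simp
  moreover have "(\<Sum>q\<in>?C. (u q)\<^sup>2) = 30 * m - 5 * m\<^sup>2"
    using plane_square_sum [where n = n and c = c] m card_plane [OF n] by (simp add: power_mult_distrib)
  ultimately show ?thesis
    using m by (intro that)
qed

text \<open>Adding the square sums of the five planes and comparing with
  \<open>total_square_sum\<close> determines the sum of the \<open>(m c)\<^sup>2\<close>.\<close>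

lemma parallel_plane_sums:
  assumes n: "n \<noteq> 0"
  obtains m where "\<And>c. m c \<ge> 0" "\<And>c. (\<Sum>q | dot n q = c. u q) = 5 * m c"
    "\<And>c. (\<Sum>q | dot n q = c. (u q)\<^sup>2) = 30 * m c - 5 * (m c)\<^sup>2"
    "sum m UNIV = int x" "6 * (\<Sum>c\<in>UNIV. (m c)\<^sup>2) = int x * (int x + 5)"
proof -
  have "\<forall>c. \<exists>m. m \<ge> 0 \<and> (\<Sum>q | dot n q = c. u q) = 5 * m \<and>
      (\<Sum>q | dot n q = c. (u q)\<^sup>2) = 30 * m - 5 * m\<^sup>2"
    using plane_sums [OF n] by metis
  then obtain m where m: "\<And>c. m c \<ge> 0" "\<And>c. (\<Sum>q | dot n q = c. u q) = 5 * m c"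
    "\<And>c. (\<Sum>q | dot n q = c. (u q)\<^sup>2) = 30 * m c - 5 * (m c)\<^sup>2"
    by metis
  have sum_m: "sum m UNIV = int x"
    using sum_parallel_planes [of u n] by (simp add: m total_sum flip: sum_distrib_left)
  have "(\<Sum>q\<in>UNIV. (u q)\<^sup>2) = 30 * sum m UNIV - 5 * (\<Sum>c\<in>UNIV. (m c)\<^sup>2)"
    using sum_parallel_planes [of "\<lambda>q. (u q)\<^sup>2" n] by (simp add: m sum_subtractf sum_distrib_left)
  then have "6 * (\<Sum>c\<in>UNIV. (m c)\<^sup>2) = int x * (int x + 5)"
    using total_square_sum sum_m by (simp add: power2_eq_square algebra_simps)
  then show ?thesis
    using m sum_m by (intro that)
qed

text \<open>The quantity is 6 times the sum of the even numbers
  \<open>m c * (m c - 1)\<close>.\<close>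

lemma parameter_modular: "12 dvd int x * (int x - 1)"
proof -
  have "axis 1 1 \<noteq> (0 :: point)"
    by (auto simp: vec_eq_iff axis_def)
  then obtain m where m: "sum m UNIV = int x" "6 * (\<Sum>c\<in>(UNIV :: F5 set). (m c)\<^sup>2) = int x * (int x + 5)"
    by (rule parallel_plane_sums)
  have "2 dvd (\<Sum>c\<in>(UNIV :: F5 set). m c * (m c - 1))"
    by (rule dvd_sum) simp
  then have "12 dvd 6 * (\<Sum>c\<in>(UNIV :: F5 set). m c * (m c - 1))"
    by (auto elim!: dvdE)
  also have "(\<Sum>c\<in>(UNIV :: F5 set). m c * (m c - 1)) = (\<Sum>c\<in>UNIV. (m c)\<^sup>2) - sum m UNIV"
    by (simp add: power2_eq_square algebra_simps sum_subtractf)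
  also have "6 * \<dots> = int x * (int x - 1)"
    using m by (simp add: algebra_simps)
  finally show ?thesis .
qed

lemma parameter_neq_4: "x \<noteq> 4"
proof
  assume x: "x = 4"
  have "axis 1 1 \<noteq> (0 :: point)"
    by (auto simp: vec_eq_iff axis_def)
  then obtain m where m: "\<And>c. m c \<ge> 0" "\<And>c. (\<Sum>q | dot (axis 1 1) q = c. u q) = 5 * m c"
    "\<And>c. (\<Sum>q | dot (axis 1 1) q = c. (u q)\<^sup>2) = 30 * m c - 5 * (m c)\<^sup>2"
    "sum m UNIV = int x" "6 * (\<Sum>c\<in>UNIV. (m c)\<^sup>2) = int x * (int x + 5)"
    by (rule parallel_plane_sums) (rule that)
  \<comment> \<open>The \<open>m c\<close> sum to 4 and their squares to 6. Without a value 1, every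
    square would be at least \<open>2 * m c\<close>, for a total of at least 8.\<close>
  have "\<exists>c. m c = 1"
  proof (rule ccontr)
    assume no: "\<nexists>c. m c = 1"
    have "2 * m c \<le> (m c)\<^sup>2" for c
    proof -
      have "m c = 0 \<or> m c \<ge> 2"
        using no m(1) [of c] by (metis One_nat_def int_one_le_iff_zero_less le_less one_add_one zless_imp_add1_zle)
      then show ?thesis
        by (auto simp: power2_eq_square)
    qed
    then have "(\<Sum>c\<in>UNIV. 2 * m c) \<le> (\<Sum>c\<in>UNIV. (m c)\<^sup>2)"
      by (intro sum_mono)
    then show False
      using m(4,5) x by (simp flip: sum_distrib_left)
  qed
  then obtain c where "m c = 1"
    by blast
  then have sums: "(\<Sum>q | dot (axis 1 1) q = c. u q) = 5" "(\<Sum>q | dot (axis 1 1) q = c. (u q)\<^sup>2) = 25"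
    using m(2,3) [of c] by simp_all
  \<comment> \<open>From \<open>0 \<le> u q \<le> 4\<close>; on the chosen plane this would bound 25
    by 20.\<close>
  have "(u q)\<^sup>2 \<le> 4 * u q" for q
    using weight_bounds [of q] x by (simp add: power2_eq_square mult_right_mono)
  then have "(\<Sum>q | dot (axis 1 1) q = c. (u q)\<^sup>2) \<le> (\<Sum>q | dot (axis 1 1) q = c. 4 * u q)"
    by (intro sum_mono)
  then show False
    using sums by (simp flip: sum_distrib_left)
qed

lemma parameter_neq_9: "x \<noteq> 9"
proof
  assume x: "x = 9"
  have square: "(\<Sum>q\<in>UNIV. (u q)\<^sup>2) = 165" and total: "sum u UNIV = 45"
    using total_square_sum total_sum x by simp_all
  have plane_le: "m \<le> 3" if n: "n \<noteq> 0" and m: "(\<Sum>q | dot n q = c. u q) = 5 * m" for n c m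
  proof -
    obtain k where k: "\<And>c. k c \<ge> 0" "\<And>c. (\<Sum>q | dot n q = c. u q) = 5 * k c"
      "sum k UNIV = int x" "6 * (\<Sum>c\<in>UNIV. (k c)\<^sup>2) = int x * (int x + 5)"
      using n by (rule parallel_plane_sums) (rule that)
    have "k c = m"
      using k(2) [of c] m by simp
    have "sum k UNIV = 9" "(\<Sum>c\<in>UNIV. (k c)\<^sup>2) = 21"
      using k(3,4) x by simp_all
    \<comment> \<open>No integer lies strictly between the roots 1 and 2. The five terms sum to 21 -
      27 + 10 = 4, but a plane with \<open>m \<ge> 4\<close> would contribute at least 6.\<close>
    have nonneg: "(k c - 1) * (k c - 2) \<ge> 0" for c
      using k(1) [of c] by (cases "k c \<le> 1") (auto intro: mult_nonneg_nonneg mult_nonpos_nonpos)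
    have "(k c - 1) * (k c - 2) \<le> (\<Sum>c\<in>UNIV. (k c - 1) * (k c - 2))"
      using nonneg by (intro member_le_sum) auto
    also have "\<dots> = (\<Sum>c\<in>UNIV. (k c)\<^sup>2) - 3 * sum k UNIV + 10"
      by (simp add: power2_eq_square algebra_simps sum.distrib sum_subtractf flip: sum_distrib_right)
    finally have "(m - 1) * (m - 2) \<le> 4"
      using \<open>k c = m\<close> \<open>sum k UNIV = 9\<close> \<open>(\<Sum>c\<in>UNIV. (k c)\<^sup>2) = 21\<close> by simp
    moreover have "(m - 1) * (m - 2) \<ge> 3 * 2" if "m \<ge> 4"
      using that by (intro mult_mono) auto
    ultimately show ?thesis
      by linarith
  qed
  have no: "u p \<notin> {1, 2}" for p
  proof
    assume u: "u p \<in> {1, 2}"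
    let ?sum = "\<lambda>n. \<Sum>q | dot n q = dot n p. u q" and ?square = "\<lambda>n. \<Sum>q | dot n q = dot n p. (u q)\<^sup>2"
    \<comment> \<open>The left-hand side is \<open>5 * (m - 1) * (m - 3)\<close>; the case
      \<open>m = 0\<close> would make \<open>u\<close> vanish on the plane.\<close>
    have "2 * ?sum n + 15 - ?square n \<le> 0" if n: "n \<noteq> 0" for n
    proof -
      obtain m where m: "m \<ge> 0" "?sum n = 5 * m" "?square n = 30 * m - 5 * m\<^sup>2"
        using n by (rule plane_sums)
      have "m \<noteq> 0"
      proof
        assume "m = 0"
        then have "?square n = 0"
          using m by simp
        then have "u p = 0"
          by (simp add: sum_nonneg_eq_0_iff)
        then show False
          using u by simp
      qed
      then have "(m - 1) * (m - 3) \<le> 0"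
        using m(1) plane_le [OF n m(2)] by (intro mult_nonneg_nonpos) auto
      then show ?thesis
        using m by (simp add: power2_eq_square algebra_simps)
    qed
    then have "(\<Sum>n\<in>UNIV - {0}. 2 * ?sum n + 15 - ?square n) \<le> 0"
      by (intro sum_nonpos) auto
    \<comment> \<open>This equals \<open>100 * u p * (2 - u p) + 60\<close>, which is positive for
      both values of \<open>u p\<close>.\<close>
    moreover have "(\<Sum>n\<in>UNIV - {0}. 2 * ?sum n + 15 - ?square n) =
        2 * (100 * u p + 24 * 45) + 15 * 124 - (100 * (u p)\<^sup>2 + 24 * 165)"
      using square total
      by (simp add: sum.distrib sum_subtractf sum_planes_through card_Diff_singleton flip: sum_distrib_left)
    ultimately show False
      using u by auto
  qed
  have "12 dvd (u q)\<^sup>2 + u q" for q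
  proof -
    have "u q \<in> {-1, 0, 1, 2, 3}"
      using weight_bounds [of q] x by auto
    then have "u q \<in> {-1, 0, 3}"
      using no [of q] by auto
    then show ?thesis
      by auto
  qed
  then have "12 dvd (\<Sum>q\<in>UNIV. (u q)\<^sup>2 + u q)"
    by (intro dvd_sum)
  then show False
    using square total by (simp add: sum.distrib)
qed

end

text \<open>The divisibility leaves the residues 0, 1, 4, 9 modulo 12. Among these, 4 and 9 are
  excluded directly, 21 and 16 as their complements.\<close>

lemma line_weight_parameter:
  assumes "line_weight x u"
  shows "x \<in> {0, 1, 12, 13, 24, 25}"
proof -
  have "12 dvd int x * (int x - 1)"
    using assms by (rule parameter_modular)
  moreover have "x \<noteq> 4" "x \<noteq> 9"
    using parameter_neq_4 [OF assms] parameter_neq_9 [OF assms] by auto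
  moreover have "25 - x \<noteq> 4" "25 - x \<noteq> 9"
    using parameter_neq_4 parameter_neq_9 line_weight_complement(2) [OF assms] by blast+
  moreover have "x \<le> 25"
    using assms by (rule line_weight_complement)
  then have "x = 0 \<or> x = 1 \<or> x = 2 \<or> x = 3 \<or> x = 4 \<or> x = 5 \<or> x = 6 \<or> x = 7 \<or> x = 8 \<or> x = 9 \<or> x = 10 \<or> x = 11 \<or> x = 12 \<or> 
      x = 13 \<or> x = 14 \<or> x = 15 \<or> x = 16 \<or> x = 17 \<or> x = 18 \<or> x = 19 \<or> x = 20 \<or> x = 21 \<or> x = 22 \<or> x = 23 \<or> x = 24 \<or> x = 25"
    by presburger
  ultimately show ?thesis
    by (elim disjE) simp_all
qed

section \<open>Weights with the admissible parameters\<close>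

lemma line_weight_0: "line_weight 0 (\<lambda>_. 0)"
  by (simp add: line_weight_def)

text \<open>The corresponding class is the set of all lines through the origin.\<close>

lemma line_weight_1: "line_weight 1 (\<lambda>q. if q = 0 then 5 else 0)" (is "line_weight 1 ?u")
  unfolding line_weight_def
proof (intro conjI allI impI)
  fix p d :: point assume "d \<noteq> 0"
  have "sum ?u (line p d) \<in> {0, 5}"
    by simp
  then show "(\<Sum>t\<in>UNIV. ?u (p + t *s d)) \<in> {0, 5}"
    unfolding sum_line [OF \<open>d \<noteq> 0\<close>] .
qed simp

text \<open>
  Up to a change of basis this is the norm from the field with 125 elements.
\<close>

definition cubic_form :: "point \<Rightarrow> F5" where
  "cubic_form v = (v $ 1) ^ 3 + (v $ 2) ^ 3 + (v $ 3) ^ 3 +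
    v $ 1 * (v $ 2)\<^sup>2 + v $ 2 * (v $ 3)\<^sup>2 + v $ 3 * (v $ 1)\<^sup>2"

lemma cubic_form_scale: "cubic_form (t *s v) = t ^ 3 * cubic_form v"
  by (simp add: cubic_form_def algebra_simps power2_eq_square power3_eq_cube)

text \<open>By homogeneity a nonzero first coordinate can be scaled to 1, so checking all pairs of
  remaining coordinates suffices.\<close>

lemma cubic_form_anisotropic:
  assumes "cubic_form v = 0"
  shows "v = 0"
proof (rule ccontr)
  have b: "\<forall>b c :: F5. b ^ 3 + c ^ 3 + b * c\<^sup>2 = 0 \<longrightarrow> b = 0 \<and> c = 0"
    and c: "\<forall>b c :: F5. 1 + b ^ 3 + c ^ 3 + b\<^sup>2 + b * c\<^sup>2 + c \<noteq> 0"
    by (simp_all add: all_F5)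
  assume "v \<noteq> 0"
  show False
  proof (cases "v $ 1 = 0")
    case True
    then have "(v $ 2) ^ 3 + (v $ 3) ^ 3 + v $ 2 * (v $ 3)\<^sup>2 = 0"
      using assms by (simp add: cubic_form_def)
    then have "v $ 2 = 0 \<and> v $ 3 = 0"
      using b by blast
    with True \<open>v \<noteq> 0\<close> show False
      by (simp add: vec_eq_iff forall_3)
  next
    case False
    then obtain s where "v $ 1 * s = 1"
      using F5_inverse by blast
    then have "cubic_form (s *s v) \<noteq> 0"
      using c by (simp add: cubic_form_def mult.commute [of s])
    then show False
      using assms by (simp add: cubic_form_scale)
  qed
qed

lemma cubic_form_line:
  obtains b c where "\<And>t. cubic_form (p + t *s d) = cubic_form p + b * t + c * t\<^sup>2 + cubic_form d * t ^ 3"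
proof -
  \<comment> \<open>The form is a sum of six terms \<open>x * z\<^sup>2\<close> in the coordinates;
    \<open>B\<close> and \<open>C\<close> are the coefficients of \<open>t\<close> and
    \<open>t\<^sup>2\<close> in one such term along a line.\<close>
  define B where "B x y z w = y * z\<^sup>2 + (x * z * w + x * z * w)" for x y z w :: F5
  define C where "C x y z w = x * w\<^sup>2 + (y * z * w + y * z * w)" for x y z w :: F5
  have expand: "(x + t * y) * (z + t * w)\<^sup>2 = x * z\<^sup>2 + B x y z w * t + C x y z w * t\<^sup>2 + y * w\<^sup>2 * t ^ 3" for x y z w t
    by (simp add: B_def C_def power2_eq_square power3_eq_cube algebra_simps)
  have cube: "x ^ 3 = x * x\<^sup>2" for x :: F5
    by (simp add: power2_eq_square power3_eq_cube)
  let ?coeff = "\<lambda>f. f (p $ 1) (d $ 1) (p $ 1) (d $ 1) + f (p $ 2) (d $ 2) (p $ 2) (d $ 2) +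
    f (p $ 3) (d $ 3) (p $ 3) (d $ 3) + f (p $ 1) (d $ 1) (p $ 2) (d $ 2) +
    f (p $ 2) (d $ 2) (p $ 3) (d $ 3) + f (p $ 3) (d $ 3) (p $ 1) (d $ 1)"
  have "cubic_form (p + t *s d) = cubic_form p + ?coeff B * t + ?coeff C * t\<^sup>2 + cubic_form d * t ^ 3" for t
    unfolding cubic_form_def vector_add_component vector_smult_component cube [of "_ $ _"] cube [of "_ + _"] expand
    by (simp only: distrib_left distrib_right ac_simps)
  then show ?thesis
    by (rule that)
qed

text \<open>Nonzero elements have fourth power 1, so summing a polynomial of degree at most 4 over
  the field isolates its coefficient of \<open>t ^ 4\<close>.\<close>

lemma sum_F5_powers:
  "(\<Sum>t\<in>UNIV. t :: F5) = 0" "(\<Sum>t\<in>UNIV. t\<^sup>2 :: F5) = 0" "(\<Sum>t\<in>UNIV. t ^ 3 :: F5) = 0"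
  "(\<Sum>t\<in>UNIV. t ^ 4 :: F5) = 4"
  by (simp_all add: sum_F5)

lemma sum_cubic_form_line: "(\<Sum>t\<in>UNIV. cubic_form (p + t *s d)) = 0"
proof -
  obtain b c where "\<And>t. cubic_form (p + t *s d) = cubic_form p + b * t + c * t\<^sup>2 + cubic_form d * t ^ 3"
    by (rule cubic_form_line) blast
  moreover have "5 * a = 0" for a :: F5
  proof -
    have "(5 :: F5) = 0"
      by simp
    then show ?thesis
      by (simp only: mult_zero_left)
  qed
  ultimately show ?thesis
    by (simp add: sum.distrib sum_F5_powers flip: sum_distrib_left)
qed

lemma cubic_form_not_constant:
  assumes "d \<noteq> 0"
  shows "\<exists>t. cubic_form (p + t *s d) \<noteq> k"
proof (rule ccontr)
  assume "\<not> ?thesis"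
  then have const: "cubic_form (p + t *s d) = k" for t
    by blast
  obtain b c where line: "\<And>t. cubic_form (p + t *s d) = cubic_form p + b * t + c * t\<^sup>2 + cubic_form d * t ^ 3"
    by (rule cubic_form_line) blast
  \<comment> \<open>Multiplying by \<open>t\<close> moves the leading coefficient
    \<open>cubic_form d\<close> to degree 4, where summation over the field detects it.\<close>
  have "t * k = cubic_form p * t + b * t\<^sup>2 + c * t ^ 3 + cubic_form d * t ^ 4" for t
    using line [of t] const [of t] by (simp add: algebra_simps eval_nat_numeral)
  then have "(\<Sum>t\<in>UNIV. t * k) =
      (\<Sum>t\<in>UNIV. cubic_form p * t + b * t\<^sup>2 + c * t ^ 3 + cubic_form d * t ^ 4)"
    by simp
  then have "cubic_form d * 4 = 0"
    by (simp add: sum.distrib sum_F5_powers flip: sum_distrib_left sum_distrib_right)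
  then have "cubic_form d = 0"
    using F5_times_eq_0 [of "cubic_form d" 4] by simp
  then show False
    using assms cubic_form_anisotropic by blast
qed

definition residue :: "F5 \<Rightarrow> int" where
  "residue a = (if a = 0 then 0 else if a = 1 then 1 else if a = 2 then 2 else if a = 3 then 3 else 4)"

lemma of_int_residue: "of_int (residue a) = a"
proof -
  have "\<forall>a. of_int (residue a) = a"
    by (simp add: all_F5 residue_def)
  then show ?thesis
    by blast
qed

lemma residue_inject: "residue a = residue b \<Longrightarrow> a = b"
  by (metis of_int_residue)

lemma residue_bounds: "a \<noteq> 0 \<Longrightarrow> 1 \<le> residue a" "residue a \<le> 4"
  by (simp_all add: residue_def)

text \<open>Cubing permutes the field because 3 is coprime to 4, so the residues 0 to 4 each occur
  once.\<close>

lemma sum_residue_cubes: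
  assumes "a \<noteq> 0"
  shows "(\<Sum>t\<in>UNIV. residue (t ^ 3 * a)) = 10"
proof -
  have "\<forall>a. a \<noteq> 0 \<longrightarrow> (\<Sum>t\<in>UNIV. residue (t ^ 3 * a)) = 10"
    unfolding sum_F5 by (simp add: all_F5 residue_def)
  then show ?thesis
    using assms by blast
qed

lemma sum_residue_line_origin:
  assumes "d \<noteq> 0"
  shows "(\<Sum>t\<in>UNIV. residue (cubic_form (0 + t *s d))) = 10"
  using sum_residue_cubes [of "cubic_form d"] cubic_form_anisotropic [of d] assms
  by (auto simp: cubic_form_scale)

text \<open>
  Off the origin the five residues lie between 1 and 4, their sum is divisible by 5, and they
  are not all equal, so the extreme values 5 and 20 of the sum do not occur.
\<close>

lemma sum_residue_line:
  assumes d: "d \<noteq> 0"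
  shows "(\<Sum>t\<in>UNIV. residue (cubic_form (p + t *s d))) \<in> {10, 15}"
proof (cases "0 \<in> line p d")
  case True
  then have "(\<Sum>q\<in>line p d. residue (cubic_form q)) = (\<Sum>q\<in>line 0 d. residue (cubic_form q))"
    by (simp add: line_eqI)
  then show ?thesis
    unfolding sum_line [OF d] sum_residue_line_origin [OF d] by simp
next
  case False
  define r where "r = (\<lambda>t. residue (cubic_form (p + t *s d)))"
  have r: "1 \<le> r t" "r t \<le> 4" for t
  proof -
    have "p + t *s d \<noteq> 0"
      using False by (auto simp: line_def image_iff)
    then have "cubic_form (p + t *s d) \<noteq> 0"
      using cubic_form_anisotropic by blast
    then show "1 \<le> r t" "r t \<le> 4"
      unfolding r_def by (simp_all add: residue_bounds)
  qed
  have not_const: "\<exists>t. r t \<noteq> r 0"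
    using cubic_form_not_constant [OF d, of p "cubic_form (p + 0 *s d)"] residue_inject
    unfolding r_def by blast
  have "(of_int (sum r UNIV) :: F5) = 0"
    by (simp add: r_def of_int_residue sum_cubic_form_line)
  then have "5 dvd sum r UNIV"
    unfolding of_int_eq_0_iff_char_dvd by simp
  then obtain k where k: "sum r UNIV = 5 * k"
    by (rule dvdE)
  have low: "sum r UNIV \<noteq> 5"
  proof
    assume "sum r UNIV = 5"
    then have "(\<Sum>t\<in>UNIV. r t - 1) = 0"
      by (simp add: sum_subtractf)
    moreover have "0 \<le> r t - 1" for t
      using r(1) [of t] by linarith
    ultimately have "r t = 1" for t
      by (subst (asm) sum_nonneg_eq_0_iff) auto
    then show False
      using not_const by simp
  qed
  have high: "sum r UNIV \<noteq> 20"
  proof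
    assume "sum r UNIV = 20"
    then have "(\<Sum>t\<in>UNIV. 4 - r t) = 0"
      by (simp add: sum_subtractf)
    then have "r t = 4" for t
      using r by (subst (asm) sum_nonneg_eq_0_iff) auto
    then show False
      using not_const by simp
  qed
  have "(\<Sum>t\<in>(UNIV :: F5 set). 1) \<le> sum r UNIV" "sum r UNIV \<le> (\<Sum>t\<in>(UNIV :: F5 set). 4)"
    by (rule sum_mono, rule r)+
  then have "k \<in> {2, 3}"
    using low high k by auto
  then show ?thesis
    using k unfolding r_def by auto
qed

lemma line_weight_12: "line_weight 12 (\<lambda>q. residue (cubic_form q) - 2)" (is "line_weight 12 ?u")
  unfolding line_weight_def
proof (intro conjI allI impI)
  fix p d :: point assume "d \<noteq> 0"
  then show "(\<Sum>t\<in>UNIV. ?u (p + t *s d)) \<in> {0, 5}"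
    using sum_residue_line [of d p] by (auto simp: sum_subtractf)
next
  \<comment> \<open>Every line through the origin has weight 0 and the origin has weight -2, so
    \<open>0 = 120 * (-2) + 4 * sum ?u UNIV\<close> gives the total 60.\<close>
  have "(\<Sum>d\<in>UNIV - {0}. \<Sum>t\<in>UNIV. ?u (0 + t *s d)) =
      (int (card (UNIV :: point set)) - 5) * ?u 0 + 4 * (\<Sum>v\<in>UNIV. ?u (0 + v))"
    by (rule sum_lines_through) auto
  moreover have "(\<Sum>t\<in>UNIV. ?u (0 + t *s d)) = 0" if "d \<in> UNIV - {0}" for d
  proof -
    have "d \<noteq> 0"
      using that by simp
    then show ?thesis
      unfolding sum_subtractf by (subst sum_residue_line_origin) simp_all
  qed
  moreover have "?u 0 = - 2"
    by (simp add: cubic_form_def residue_def)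
  ultimately show "sum ?u UNIV = 5 * int 12"
    by simp
qed

theorem corollary7p5:
  fixes x :: nat
  shows "(\<exists>L. cameron_liebler_line_class x L) \<longleftrightarrow> x \<in> {0, 1, 12, 13, 24, 25}"
  unfolding line_class_iff_weight
proof
  assume "\<exists>u. line_weight x u"
  then show "x \<in> {0, 1, 12, 13, 24, 25}"
    using line_weight_parameter by blast
next
  assume "x \<in> {0, 1, 12, 13, 24, 25}"
  moreover have "\<exists>u. line_weight (25 - y) u" if "line_weight y v" for y v
    using line_weight_complement(2) [OF that] by blast
  from this [OF line_weight_0] this [OF line_weight_1] this [OF line_weight_12]
  have "\<exists>u. line_weight 25 u" "\<exists>u. line_weight 24 u" "\<exists>u. line_weight 13 u"
    by simp_all
  ultimately show "\<exists>u. line_weight x u"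
    using line_weight_0 line_weight_1 line_weight_12 by auto
qed

end
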